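(* Consider the SUM cost on an $s$–$t$ graph $G$ with $n\ge 1$ agents and $k\ge 1$ interceptors. Let $\varepsilon>0$ and let $\alpha>0$ satisfy $\alpha\ge\frac{m_c}{k\varepsilon}\left(n|p_{max}|-(1+\varepsilon)|p_{min}|\right)$. Then $$\frac{r(G,n,k,\alpha)}{r_U(G,n,k,\alpha)}\in\left[\frac{1}{1+\varepsilon},\,1+\varepsilon\right].$$
   Context: Graph: $G=(V,E,s,t)$ is a finite directed acyclic multigraph ($E$ is a multiset) with source $s$ and sink $t\neq s$, such that $E\ne\emptyset$ and every edge lies on some directed $s$–$t$ path. $P_{st}$ is the set of directed $s$–$t$ paths; a path is treated as a set of edges and $|p|$ is its number of edges. $p_{max},p_{min}$ are a longest and a shortest path in $P_{st}$. $m_c=m_c(G)$ is the minimum size of an $s$–$t$ cut of $G$. Strategies: each of the $n$ agents picks a path, giving $a=(a_1,\dots,a_n)\in(P_{st})^n$, with $\bigcup a=\bigcup_i a_i\subseteq E$; the $k$ interceptors pick $d=(d_1,\dots,d_k)\in E^k$. $\Delta X$ is the set of probability distributions on $X$. An element $\sigma=(\sigma_1,\dots,\sigma_n)\in(\Delta(P_{st}))^n$ is identified with the product distribution on $(P_{st})^n$ (uncorrelated agents); correlated agents use arbitrary $\sigma\in\Delta((P_{st})^n)$. SUM cost: $C(a,d,\alpha)=\left|\bigcup a\right|+\alpha\sum_{j\le k}\mathbf 1\{d_j\in\bigcup a\}$. For a distribution $\sigma$ on $(P_{st})^n$, $F_n(\sigma,\alpha)=\max_{d\in E^k}\mathbb{E}_{a\sim\sigma}[C(a,d,\alpha)]$.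 Price of uncorrelation: $$r(G,n,k,\alpha)=\frac{\min_{\sigma\in(\Delta(P_{st}))^n}F_n(\sigma,\alpha)}{\min_{\sigma\in\Delta((P_{st})^n)}F_n(\sigma,\alpha)}.$$ Uniform strategies: let $MF$ be the collection of inclusion-maximal sets of pairwise edge-disjoint $s$–$t$ paths. For each such set, order its paths as $p_1,\dots,p_{m'}$ with $|p_1|\le\dots\le|p_{m'}|$; its prefixes are the sets $\{p_1,\dots,p_i\}$, $1\le i\le m'$. $\mathcal{U}_n$ is the set of all $U_P^n$ where $P$ is a prefix of some member of $MF$, $U_P$ is the uniform distribution on $P$, and $U_P^n$ is the product of $n$ copies of $U_P$. The uniform price of uncorrelation is $$r_U(G,n,k,\alpha)=\frac{\min_{\sigma\in\mathcal{U}_n}F_n(\sigma,\alpha)}{\min_{\sigma\in\mathcal{U}_1}F_1(\sigma,\alpha)}.$$ *)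

theory Defs
  imports
    "Graph_Theory.Arc_Walk"
    "HOL-Probability.Product_PMF"
    "HOL-Library.Disjoint_Sets"
begin

text \<open>
  Arcs of a \<^typ>\<open>('a, 'b) pre_digraph\<close> have an identity of their own, so parallel arcs are
  distinct elements of the arc set; this is how the multiset of edges is represented.
  A path is identified with its set of arcs, which determines it.
\<close>

definition st_paths :: "('a, 'b) pre_digraph \<Rightarrow> 'a \<Rightarrow> 'a \<Rightarrow> 'b set set" where
  "st_paths G s t = {set p | p. pre_digraph.apath G s p t}"

locale st_graph = fin_digraph G for G :: "('a, 'b) pre_digraph" (structure) +
  fixes s t :: 'a
  assumes source_in_verts: "s \<in> verts G"
    and sink_in_verts: "t \<in> verts G"
    and source_neq_sink: "t \<noteq> s"
    and dag: "\<nexists>c. cycle c"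
    and arcs_nonempty: "arcs G \<noteq> {}"
    and arc_on_st_path: "e \<in> arcs G \<Longrightarrow> \<exists>p \<in> st_paths G s t. e \<in> p"

definition longest_path_length :: "('a, 'b) pre_digraph \<Rightarrow> 'a \<Rightarrow> 'a \<Rightarrow> nat" where
  "longest_path_length G s t = Max (card ` st_paths G s t)"

definition shortest_path_length :: "('a, 'b) pre_digraph \<Rightarrow> 'a \<Rightarrow> 'a \<Rightarrow> nat" where
  "shortest_path_length G s t = Min (card ` st_paths G s t)"

text \<open>A cut is a set of arcs whose removal leaves no directed path from source to sink.\<close>

definition st_cut :: "('a, 'b) pre_digraph \<Rightarrow> 'a \<Rightarrow> 'a \<Rightarrow> 'b set \<Rightarrow> bool" where
  "st_cut G s t K \<longleftrightarrow> K \<subseteq> arcs G \<and> \<not> (\<exists>p \<in> st_paths G s t. p \<subseteq> arcs G - K)"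

definition min_cut :: "('a, 'b) pre_digraph \<Rightarrow> 'a \<Rightarrow> 'a \<Rightarrow> nat" where
  "min_cut G s t = Min (card ` {K. st_cut G s t K})"

text \<open>
  Agents are indexed by \<open>{..<n}\<close> and interceptors by \<open>{..<k}\<close>; tuples are extensional
  functions on these index sets. The default value \<^term>\<open>undefined\<close> of \<^const>\<open>Pi_pmf\<close>
  below therefore makes product distributions live on extensional functions.
\<close>

definition agent_profiles :: "('a, 'b) pre_digraph \<Rightarrow> 'a \<Rightarrow> 'a \<Rightarrow> nat \<Rightarrow> (nat \<Rightarrow> 'b set) set" where
  "agent_profiles G s t n = {..<n} \<rightarrow>\<^sub>E st_paths G s t"

definition interceptor_profiles :: "('a, 'b) pre_digraph \<Rightarrow> nat \<Rightarrow> (nat \<Rightarrow> 'b) set" where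
  "interceptor_profiles G k = {..<k} \<rightarrow>\<^sub>E arcs G"

definition distributions :: "'c set \<Rightarrow> 'c pmf set" where
  "distributions X = {\<mu>. set_pmf \<mu> \<subseteq> X}"

definition sum_cost :: "nat \<Rightarrow> nat \<Rightarrow> real \<Rightarrow> (nat \<Rightarrow> 'b set) \<Rightarrow> (nat \<Rightarrow> 'b) \<Rightarrow> real" where
  "sum_cost n k \<alpha> a d =
     real (card (\<Union>i<n. a i)) + \<alpha> * (\<Sum>j<k. of_bool (d j \<in> (\<Union>i<n. a i)))"

definition worst_cost ::
    "('a, 'b) pre_digraph \<Rightarrow> nat \<Rightarrow> nat \<Rightarrow> real \<Rightarrow> (nat \<Rightarrow> 'b set) pmf \<Rightarrow> real" where
  "worst_cost G n k \<alpha> \<sigma> =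
     (MAX d \<in> interceptor_profiles G k. measure_pmf.expectation \<sigma> (\<lambda>a. sum_cost n k \<alpha> a d))"

definition correlated_strategies ::
    "('a, 'b) pre_digraph \<Rightarrow> 'a \<Rightarrow> 'a \<Rightarrow> nat \<Rightarrow> (nat \<Rightarrow> 'b set) pmf set" where
  "correlated_strategies G s t n = distributions (agent_profiles G s t n)"

definition uncorrelated_strategies ::
    "('a, 'b) pre_digraph \<Rightarrow> 'a \<Rightarrow> 'a \<Rightarrow> nat \<Rightarrow> (nat \<Rightarrow> 'b set) pmf set" where
  "uncorrelated_strategies G s t n =
     Pi_pmf {..<n} undefined ` ({..<n} \<rightarrow>\<^sub>E distributions (st_paths G s t))"

text \<open>
  Both minima range over nonempty compact sets of distributions, on which the worst-case cost is
  continuous and nonnegative (for \<open>\<alpha> \<ge> 0\<close>); so each infimum is attained and is the minimum.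
\<close>

definition price_of_uncorrelation ::
    "('a, 'b) pre_digraph \<Rightarrow> 'a \<Rightarrow> 'a \<Rightarrow> nat \<Rightarrow> nat \<Rightarrow> real \<Rightarrow> real" where
  "price_of_uncorrelation G s t n k \<alpha> =
     (INF \<sigma> \<in> uncorrelated_strategies G s t n. worst_cost G n k \<alpha> \<sigma>) /
     (INF \<sigma> \<in> correlated_strategies G s t n. worst_cost G n k \<alpha> \<sigma>)"

definition max_disjoint_path_sets :: "('a, 'b) pre_digraph \<Rightarrow> 'a \<Rightarrow> 'a \<Rightarrow> 'b set set set" where
  "max_disjoint_path_sets G s t =
     {M. M \<subseteq> st_paths G s t \<and> disjoint M \<and>
         (\<forall>M'. M' \<subseteq> st_paths G s t \<and> disjoint M' \<and> M \<subseteq> M' \<longrightarrow> M' = M)}"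

text \<open>
  Paths of equal length may be ordered either way. The worst-case cost of a uniform strategy
  depends only on the number and the total length of the paths in its prefix, so admitting every
  length-sorted order gives the same minima as fixing one.
\<close>

definition path_prefixes :: "'b set set \<Rightarrow> 'b set set set" where
  "path_prefixes M =
     {set (take i ps) | i ps.
        set ps = M \<and> distinct ps \<and> sorted (map card ps) \<and> 1 \<le> i \<and> i \<le> length ps}"

definition uniform_strategies ::
    "('a, 'b) pre_digraph \<Rightarrow> 'a \<Rightarrow> 'a \<Rightarrow> nat \<Rightarrow> (nat \<Rightarrow> 'b set) pmf set" where
  "uniform_strategies G s t n =
     {Pi_pmf {..<n} undefined (\<lambda>_. pmf_of_set P) | P.
        \<exists>M \<in> max_disjoint_path_sets G s t. P \<in> path_prefixes M}"

definition uniform_price_of_uncorrelation ::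
    "('a, 'b) pre_digraph \<Rightarrow> 'a \<Rightarrow> 'a \<Rightarrow> nat \<Rightarrow> nat \<Rightarrow> real \<Rightarrow> real" where
  "uniform_price_of_uncorrelation G s t n k \<alpha> =
     (MIN \<sigma> \<in> uniform_strategies G s t n. worst_cost G n k \<alpha> \<sigma>) /
     (MIN \<sigma> \<in> uniform_strategies G s t 1. worst_cost G 1 k \<alpha> \<sigma>)"

end

theory Submission
  imports Defs
begin

text \<open>
  Let \<open>m\<close> be the minimum cut. Interceptors concentrated on one arc of a minimum cut force a cost of
  at least \<open>|p_min| + \<alpha> k / m\<close> on correlated agents and, by the AM-GM inequality over the cut, at
  least \<open>|p_min| + \<alpha> k (1 - (1 - 1/m)^n)\<close> on uncorrelated ones. By Menger's theorem there are
  \<open>m\<close> arc-disjoint paths; playing uniformly on them attains the same bounds except that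
  \<open>|p_min|\<close> becomes \<open>n |p_max|\<close> (\<open>|p_max|\<close> for one agent). The hypothesis on \<open>\<alpha>\<close> makes this loss at
  most a factor \<open>1 + \<epsilon>\<close>. Since uniform strategies are uncorrelated, and one agent's strategy can be
  copied by \<open>n\<close> correlated agents, the price of uncorrelation divided by its uniform version is a
  product of a number in \<open>[1 / (1 + \<epsilon>), 1]\<close> and one in \<open>[1, 1 + \<epsilon>]\<close>.

  Menger's theorem is proved by augmentation, with integral flows represented by sets of arcs.
\<close>

section \<open>Integral flows as sets of arcs, and their augmentation\<close>

context fin_digraph
begin

text \<open>Net outflow at \<open>v\<close> of the 0/1 flow whose support is \<open>F\<close>; it
  takes values in \<open>int\<close> because it is negative at the sink of a flow of positive
  value.\<close>

definition excess :: "'b set \<Rightarrow> 'a \<Rightarrow> int" where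
  "excess F v = (\<Sum>e\<in>F. of_bool (tail G e = v) - of_bool (head G e = v))"

definition st_flow :: "'a \<Rightarrow> 'a \<Rightarrow> 'b set \<Rightarrow> bool" where
  "st_flow s t F \<longleftrightarrow> F \<subseteq> arcs G \<and> (\<forall>v. v \<noteq> s \<longrightarrow> v \<noteq> t \<longrightarrow> excess F v = 0)"

lemma sum_excess:
  assumes "finite S"
  shows "(\<Sum>v\<in>S. excess F v) = (\<Sum>e\<in>F. of_bool (tail G e \<in> S) - of_bool (head G e \<in> S))"
proof -
  have "(\<Sum>v\<in>S. excess F v) =
      (\<Sum>e\<in>F. \<Sum>v\<in>S. of_bool (tail G e = v) - of_bool (head G e = v))"
    unfolding excess_def by (rule sum.swap)
  also have "\<dots> = (\<Sum>e\<in>F. of_bool (tail G e \<in> S) - of_bool (head G e \<in> S))"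
    using assms by (simp add: sum_subtractf of_bool_def)
  finally show ?thesis .
qed

text \<open>Summing the excess over \<open>S\<close>, conservation kills every term except that of
  \<open>s\<close>, while arcs with both ends in \<open>S\<close> cancel. The value of the flow is
  therefore its net flow across the boundary of \<open>S\<close>.\<close>

lemma excess_source_eq:
  assumes "st_flow s t F" "finite S" "s \<in> S" "t \<notin> S"
  shows "excess F s = (\<Sum>e\<in>F. of_bool (tail G e \<in> S) - of_bool (head G e \<in> S))"
proof -
  have "(\<Sum>v\<in>S. excess F v) = (\<Sum>v\<in>S. if v = s then excess F s else 0)"
    using assms by (intro sum.cong) (auto simp: st_flow_def)
  with assms show ?thesis by (simp add: sum_excess)
qed

lemma excess_insert:
  assumes "finite F" "e \<notin> F"
  shows "excess (insert e F) v = excess F v + of_bool (tail G e = v) - of_bool (head G e = v)"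
  using assms by (simp add: excess_def)

lemma excess_remove:
  assumes "finite F" "e \<in> F"
  shows "excess (F - {e}) v = excess F v - of_bool (tail G e = v) + of_bool (head G e = v)"
  using assms by (simp add: excess_def sum_diff1)

lemma excess_Diff:
  assumes "finite F" "P \<subseteq> F"
  shows "excess (F - P) v = excess F v - excess P v"
  using assms by (simp add: excess_def sum_diff)

text \<open>The contributions telescope along the walk; distinctness ensures that passing to
  \<open>set p\<close> counts each arc once.\<close>

lemma excess_awalk:
  assumes "awalk u p w" "distinct p"
  shows "excess (set p) v = of_bool (u = v) - of_bool (w = v)"
  using assms
  by (induction p arbitrary: u) (auto simp: awalk_simps excess_insert, simp add: excess_def)

text \<open>A walk in the residual graph of \<open>F\<close>, recorded by arcs of \<open>G\<close>
  alone: membership in \<open>F\<close> decides whether an arc is cancelled (traversed backwards) or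
  added (traversed forwards).\<close>

fun residual_walk :: "'b set \<Rightarrow> 'a \<Rightarrow> 'b list \<Rightarrow> 'a \<Rightarrow> bool" where
  "residual_walk F v [] w \<longleftrightarrow> v = w"
| "residual_walk F v (e # es) w \<longleftrightarrow> e \<in> arcs G \<and>
     (if e \<in> F then head G e = v \<and> residual_walk F (tail G e) es w
      else tail G e = v \<and> residual_walk F (head G e) es w)"

lemma residual_walk_cong:
  assumes "\<forall>e\<in>set es. e \<in> F' \<longleftrightarrow> e \<in> F"
  shows "residual_walk F' v es w \<longleftrightarrow> residual_walk F v es w"
  using assms by (induction es arbitrary: v) simp_all

lemma residual_walk_suffix:
  assumes "residual_walk F v (xs @ e # ys) w"
  shows "residual_walk F (if e \<in> F then head G e else tail G e) (e # ys) w"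
  using assms by (induction xs arbitrary: v) (auto split: if_splits)

text \<open>If \<open>e\<close> recurs in \<open>es\<close>, membership in \<open>F\<close> fixes
  its direction, so the later occurrence also starts at \<open>v\<close>. Dropping everything before
  it removes the repetition.\<close>

lemma residual_walk_Cons_distinct:
  assumes "residual_walk F v (e # es) w" "distinct es"
  shows "\<exists>es'. distinct es' \<and> residual_walk F v es' w"
proof (cases "e \<in> set es")
  case True
  then obtain xs ys where es: "es = xs @ e # ys" by (meson split_list)
  have "residual_walk F v ((e # xs) @ e # ys) w" using assms(1) es by simp
  from residual_walk_suffix[OF this] have "residual_walk F v (e # ys) w"
    using assms(1) by (auto split: if_splits)
  moreover have "distinct (e # ys)" using assms(2) es by simp
  ultimately show ?thesis by blast
next
  case False
  with assms show ?thesis by (intro exI[of _ "e # es"]) auto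
qed

text \<open>The arcs of the walk are toggled one at a time. As they are distinct, toggling the first
  does not change which later arcs belong to the set, so the remaining list is still a residual walk
  for the modified set.\<close>

lemma augment:
  assumes "residual_walk F v es w" "distinct es" "F \<subseteq> arcs G"
  shows "\<exists>F' \<subseteq> arcs G. \<forall>x. excess F' x = excess F x + of_bool (v = x) - of_bool (w = x)"
  using assms
proof (induction es arbitrary: F v)
  case Nil
  then show ?case by auto
next
  case (Cons e es)
  have fin: "finite F" using Cons.prems(3) finite_arcs finite_subset by blast
  show ?case
  proof (cases "e \<in> F")
    case True
    have "residual_walk (F - {e}) (tail G e) es w"
      using Cons.prems True by (subst residual_walk_cong[of _ _ F]) auto
    from Cons.IH[OF this] Cons.prems obtain F' where "F' \<subseteq> arcs G"
      "\<forall>x. excess F' x = excess (F - {e}) x + of_bool (tail G e = x) - of_bool (w = x)"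
      by auto
    then show ?thesis
      using True Cons.prems fin by (intro exI[of _ F']) (auto simp: excess_remove)
  next
    case False
    have "residual_walk (insert e F) (head G e) es w"
      using Cons.prems False by (subst residual_walk_cong[of _ _ F]) auto
    from Cons.IH[OF this] Cons.prems False obtain F' where "F' \<subseteq> arcs G"
      "\<forall>x. excess F' x = excess (insert e F) x + of_bool (head G e = x) - of_bool (w = x)"
      by auto
    then show ?thesis
      using False Cons.prems fin by (intro exI[of _ F']) (auto simp: excess_insert)
  qed
qed

section \<open>Maximum flow, minimum cut and Menger's theorem\<close>

lemma awalk_leaves:
  assumes "awalk u p w" "u \<in> S" "w \<notin> S"
  shows "\<exists>e\<in>set p. tail G e \<in> S \<and> head G e \<notin> S"
  using assms by (induction p arbitrary: u) (auto simp: awalk_simps)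

lemma finite_st_paths: "finite (st_paths G s t)"
proof -
  have "st_paths G s t = set ` {p. apath s p t}" by (auto simp: st_paths_def)
  then show ?thesis using apaths_finite by simp
qed

lemma st_path_subset_arcs: "p \<in> st_paths G s t \<Longrightarrow> p \<subseteq> arcs G"
  by (auto simp: st_paths_def apath_def)

text \<open>Take a flow of maximum value and the set \<open>S\<close> of vertices that cannot reach
  \<open>t\<close> in its residual graph. No arc of the flow enters \<open>S\<close> and every arc
  leaving \<open>S\<close> is used, so the flow value is the size of the cut of arcs leaving
  \<open>S\<close>.\<close>

lemma max_flow_cut:
  assumes "s \<in> verts G" "s \<noteq> t"
  shows "\<exists>F K. st_flow s t F \<and> st_cut G s t K \<and> excess F s = int (card K)"
proof -
  have fin: "finite {F. st_flow s t F}"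
    by (rule finite_subset[of _ "Pow (arcs G)"]) (auto simp: st_flow_def)
  have "st_flow s t {}" by (simp add: st_flow_def excess_def)
  then obtain F where F: "st_flow s t F"
    and max: "\<And>F'. st_flow s t F' \<Longrightarrow> excess F' s \<le> excess F s"
  proof -
    let ?X = "(\<lambda>F. excess F s) ` {F. st_flow s t F}"
    have "Max ?X \<in> ?X" using fin \<open>st_flow s t {}\<close> by (intro Max_in) auto
    moreover have "excess F' s \<le> Max ?X" if "st_flow s t F'" for F'
      using fin that by (intro Max_ge) auto
    ultimately show ?thesis using that by auto
  qed
  \<comment> \<open>Only distinct residual walks count, since \<open>augment\<close> requires
    distinctness; \<open>residual_walk_Cons_distinct\<close> restores it whenever such a walk is
    extended by an arc.\<close>
  define S where "S = {v \<in> verts G. \<not> (\<exists>es. distinct es \<and> residual_walk F v es t)}"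
  have "\<not> residual_walk F s es t" if "distinct es" for es
  proof
    assume "residual_walk F s es t"
    from augment[OF this that] F obtain F' where F': "F' \<subseteq> arcs G"
      "\<And>x. excess F' x = excess F x + of_bool (s = x) - of_bool (t = x)"
      by (auto simp: st_flow_def)
    with F have "st_flow s t F'" by (auto simp: st_flow_def)
    from max[OF this] F'(2)[of s] assms show False by simp
  qed
  then have s: "s \<in> S" using assms by (auto simp: S_def)
  have t: "t \<notin> S" by (auto simp: S_def intro: exI[of _ "[]"])
  have step: "tail G e \<in> S" if "e \<in> F" "head G e \<in> S" for e
  proof -
    have e: "e \<in> arcs G" using F that by (auto simp: st_flow_def)
    have "\<not> residual_walk F (tail G e) es t" if "distinct es" for es
    proof
      assume "residual_walk F (tail G e) es t"
      then have "residual_walk F (head G e) (e # es) t" using e \<open>e \<in> F\<close> by simp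
      from residual_walk_Cons_distinct[OF this that] \<open>head G e \<in> S\<close> show False
        unfolding S_def by blast
    qed
    with e show ?thesis by (auto simp: S_def)
  qed
  have sat: "e \<in> F" if e: "e \<in> arcs G" "tail G e \<in> S" "head G e \<notin> S" for e
  proof (rule ccontr)
    assume "e \<notin> F"
    obtain es where es: "distinct es" "residual_walk F (head G e) es t"
      using e head_in_verts[of e] unfolding S_def by blast
    have "residual_walk F (tail G e) (e # es) t" using es e \<open>e \<notin> F\<close> by simp
    from residual_walk_Cons_distinct[OF this es(1)] e(2) show False
      unfolding S_def by blast
  qed
  define K where "K = {e \<in> arcs G. tail G e \<in> S \<and> head G e \<notin> S}"
  have FA: "F \<subseteq> arcs G" using F by (auto simp: st_flow_def)
  have "excess F s = (\<Sum>e\<in>F. of_bool (tail G e \<in> S) - of_bool (head G e \<in> S))"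
    by (rule excess_source_eq[OF F _ s t]) (simp add: S_def)
  also have "\<dots> = (\<Sum>e\<in>F. if e \<in> K then 1 else 0)"
    using step FA by (intro sum.cong) (auto simp: K_def)
  also have "\<dots> = int (card (F \<inter> K))"
    using finite_subset[OF FA] by (simp add: sum.If_cases)
  also have "F \<inter> K = K" using sat by (auto simp: K_def)
  finally have "excess F s = int (card K)" .
  moreover have "st_cut G s t K"
    unfolding st_cut_def st_paths_def
  proof (intro conjI notI)
    assume "\<exists>p\<in>{set p |p. apath s p t}. p \<subseteq> arcs G - K"
    then obtain p where p: "awalk s p t" "set p \<subseteq> arcs G - K" by (auto simp: apath_def)
    from awalk_leaves[OF p(1) s t] p(2) show False by (auto simp: K_def)
  qed (auto simp: K_def)
  ultimately show ?thesis using F by blast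
qed

text \<open>Induction on the flow value: a flow of positive value contains a path from
  \<open>s\<close> to \<open>t\<close>, and deleting its arcs lowers the value by one.\<close>

lemma flow_decomposition:
  assumes "st_flow s t F" "excess F s = int m" "s \<in> verts G" "s \<noteq> t"
  shows "\<exists>M \<subseteq> st_paths G s t. disjoint M \<and> card M = m \<and> \<Union>M \<subseteq> F"
  using assms(1,2)
proof (induction m arbitrary: F)
  case 0
  then show ?case by (intro exI[of _ "{}"]) auto
next
  case (Suc m)
  have FA: "F \<subseteq> arcs G" and fin: "finite F"
    using Suc.prems finite_subset[OF _ finite_arcs] by (auto simp: st_flow_def)
  define S where "S = {v \<in> verts G. \<exists>p. awalk s p v \<and> set p \<subseteq> F}"
  have s: "s \<in> S" using assms(3) by (auto simp: S_def awalk_simps intro: exI[of _ "[]"])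
  have step: "head G e \<in> S" if "e \<in> F" "tail G e \<in> S" for e
  proof -
    from that obtain p where p: "awalk s p (tail G e)" "set p \<subseteq> F" by (auto simp: S_def)
    have "awalk s (p @ [e]) (head G e)" 
      using awalk_appendI[OF p(1) arc_implies_awalk] FA that by blast
    moreover have "set (p @ [e]) \<subseteq> F" using p that by simp
    ultimately show ?thesis using FA that unfolding S_def by blast
  qed
  \<comment> \<open>Otherwise no arc of \<open>F\<close> leaves the set \<open>S\<close> reachable
    from \<open>s\<close> inside \<open>F\<close>, and the net flow out of \<open>S\<close> could
    not be positive.\<close>
  have "t \<in> S"
  proof (rule ccontr)
    assume "t \<notin> S"
    from excess_source_eq[OF Suc.prems(1) _ s this]
    have "excess F s = (\<Sum>e\<in>F. of_bool (tail G e \<in> S) - of_bool (head G e \<in> S))"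
      by (simp add: S_def)
    also have "\<dots> \<le> 0" using step by (intro sum_nonpos) auto
    finally show False using Suc.prems by simp
  qed
  then obtain q where "awalk s q t" "set q \<subseteq> F" by (auto simp: S_def)
  then obtain p where p: "apath s p t" "set p \<subseteq> F"
    using apath_awalk_to_apath awalk_to_apath_subset by (meson subset_trans)
  have "distinct p"
    using p(1) by (auto simp: apath_def awalk_verts_conv distinct_map split: if_splits)
  then have ex: "excess (F - set p) v = excess F v - of_bool (s = v) + of_bool (t = v)" for v
    using p excess_awalk[of s p t] by (subst excess_Diff[OF fin]) (auto simp: apath_def)
  then have "st_flow s t (F - set p)" "excess (F - set p) s = int m"
    using Suc.prems assms(4) by (auto simp: st_flow_def)
  from Suc.IH[OF this] obtain M where
    M: "M \<subseteq> st_paths G s t" "disjoint M" "card M = m" "\<Union>M \<subseteq> F - set p" by auto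
  \<comment> \<open>All members of \<open>M\<close> avoid the arcs of \<open>p\<close>, so a
    nonempty \<open>set p\<close> is a genuinely new member and raises the cardinality.\<close>
  have "p \<noteq> []" using p assms(4) by (auto simp: apath_def awalk_simps)
  then have "set p \<notin> M" using M(4) by (cases p) auto
  moreover have "finite M" using M(1) finite_st_paths finite_subset by blast
  ultimately have "card (insert (set p) M) = Suc m" using M by simp
  moreover have "disjoint (insert (set p) M)"
    using M by (auto simp: disjoint_def pairwise_def disjnt_def)
  ultimately show ?case
    using M p by (intro exI[of _ "insert (set p) M"]) (auto simp: st_paths_def)
qed

text \<open>Each path meets the cut; choosing one common arc per path gives an injection, since
  disjoint paths share no arc.\<close>

lemma disjoint_paths_le_cut:
  assumes "M \<subseteq> st_paths G s t" "disjoint M" "st_cut G s t K"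
  shows "card M \<le> card K"
proof -
  have "\<exists>e. e \<in> p \<inter> K" if "p \<in> M" for p
  proof -
    have p: "p \<in> st_paths G s t" using assms(1) that by auto
    then have "\<not> p \<subseteq> arcs G - K" using assms(3) by (auto simp: st_cut_def)
    with st_path_subset_arcs[OF p] show ?thesis by auto
  qed
  then obtain f where f: "\<And>p. p \<in> M \<Longrightarrow> f p \<in> p \<inter> K" by metis
  have "inj_on f M"
  proof (rule inj_onI)
    fix p q assume pq: "p \<in> M" "q \<in> M" "f p = f q"
    then have "f p \<in> p \<inter> q" using f[of p] f[of q] by simp
    then show "p = q" using disjointD[OF assms(2) pq(1,2)] by blast
  qed
  moreover have "f ` M \<subseteq> K" using f by auto
  moreover have "finite K"
    using assms(3) by (auto simp: st_cut_def intro: finite_subset[OF _ finite_arcs])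
  ultimately show ?thesis by (rule card_inj_on_le)
qed

lemma min_cut_attained:
  assumes "st_cut G s t K'"
  shows "\<exists>K. st_cut G s t K \<and> card K = min_cut G s t"
    and "min_cut G s t \<le> card K'"
proof -
  have fin: "finite {K. st_cut G s t K}"
    by (rule finite_subset[of _ "Pow (arcs G)"]) (auto simp: st_cut_def)
  have "min_cut G s t \<in> card ` {K. st_cut G s t K}"
    unfolding min_cut_def using fin assms by (intro Min_in) auto
  then show "\<exists>K. st_cut G s t K \<and> card K = min_cut G s t" by auto
  show "min_cut G s t \<le> card K'" unfolding min_cut_def using fin assms by (intro Min_le) auto
qed

text \<open>A family as large as a minimum cut cannot be extended, because the cut bounds every
  disjoint family. Hence the paths obtained from a maximum flow form an inclusion-maximal family, as
  uniform strategies require.\<close>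

lemma menger:
  assumes "s \<in> verts G" "s \<noteq> t"
  shows "\<exists>M K. M \<in> max_disjoint_path_sets G s t \<and> st_cut G s t K \<and>
    card M = min_cut G s t \<and> card K = min_cut G s t"
proof -
  obtain F K' where FK: "st_flow s t F" "st_cut G s t K'" "excess F s = int (card K')"
    using max_flow_cut[OF assms] by metis
  obtain M where M: "M \<subseteq> st_paths G s t" "disjoint M" "card M = card K'"
    using flow_decomposition[OF FK(1,3) assms] by metis
  obtain K where K: "st_cut G s t K" "card K = min_cut G s t"
    using min_cut_attained(1)[OF FK(2)] by metis
  have le: "card M' \<le> min_cut G s t" if "M' \<subseteq> st_paths G s t" "disjoint M'" for M'
    using disjoint_paths_le_cut[OF that K(1)] K(2) by simp
  have card: "card M = min_cut G s t"
    using le[OF M(1,2)] min_cut_attained(2)[OF FK(2)] M(3) by simp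
  have "M' = M" if "M' \<subseteq> st_paths G s t" "disjoint M'" "M \<subseteq> M'" for M'
  proof -
    have "finite M'" using that(1) finite_st_paths finite_subset by blast
    then show ?thesis using card_seteq[of M' M] that le[OF that(1,2)] card by simp
  qed
  then have "M \<in> max_disjoint_path_sets G s t"
    using M by (auto simp: max_disjoint_path_sets_def)
  with K card show ?thesis by (intro exI conjI)
qed

end

section \<open>AM-GM and estimates of hitting probabilities\<close>

lemma prod_le_mean_power:
  fixes x :: "'c \<Rightarrow> real"
  assumes "finite S" "S \<noteq> {}" "\<And>i. i \<in> S \<Longrightarrow> x i \<ge> 0"
  shows "(\<Prod>i\<in>S. x i) \<le> ((\<Sum>i\<in>S. x i) / card S) ^ card S"
proof -
  let ?P = "\<Prod>i\<in>S. x i" and ?m = "card S"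
  have m: "?m > 0" using assms(1,2) by (simp add: card_gt_0_iff)
  have P: "?P \<ge> 0" using assms(3) by (simp add: prod_nonneg)
  have "?P = (?P powr (1 / ?m)) ^ ?m"
    using m P by (cases "?P = 0") (simp_all add: powr_power)
  also have "\<dots> \<le> ((\<Sum>i\<in>S. x i) / ?m) ^ ?m"
    using arith_geom_mean[OF assms] by (intro power_mono) (simp_all add: sum_divide_distrib)
  finally show ?thesis .
qed

text \<open>Union bound: the events indexed by \<open>K\<close> cover the whole support of
  \<open>\<mu>\<close>.\<close>

lemma sum_prob_hits_ge_1:
  assumes "finite K" "\<And>x. x \<in> set_pmf \<mu> \<Longrightarrow> f x \<inter> K \<noteq> {}"
  shows "1 \<le> (\<Sum>e\<in>K. measure_pmf.prob \<mu> {x. e \<in> f x})"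
proof -
  have "1 = measure_pmf.prob \<mu> (\<Union>e\<in>K. {x. e \<in> f x})"
    using assms(2) by (subst eq_commute, subst measure_pmf.prob_eq_1) (auto simp: AE_measure_pmf_iff)
  also have "\<dots> \<le> (\<Sum>e\<in>K. measure_pmf.prob \<mu> {x. e \<in> f x})"
    using assms(1) by (intro measure_pmf.finite_measure_subadditive_finite) auto
  finally show ?thesis .
qed

lemma prob_pmf_Compl: "measure_pmf.prob \<mu> (- A) = 1 - measure_pmf.prob \<mu> A"
  using measure_pmf.prob_compl[of A \<mu>] by (simp add: Compl_eq_Diff_UNIV)

text \<open>By independence, the probability that all agents avoid \<open>e\<close> is a product;
  the claim is its complement.\<close>

lemma prob_Union_Pi_pmf:
  fixes n :: nat
  shows
  "measure_pmf.prob (Pi_pmf {..<n} dflt q) {a. e \<in> (\<Union>i<n. a i)} =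
    1 - (\<Prod>i<n. 1 - measure_pmf.prob (q i) {p. e \<in> p})"
proof -
  let ?A = "Pi {..<n} (\<lambda>_. - {p. e \<in> p})"
  have "{a. e \<in> (\<Union>i<n. a i)} = - ?A" by auto
  moreover have "measure_pmf.prob (Pi_pmf {..<n} dflt q) ?A =
      (\<Prod>i<n. measure_pmf.prob (q i) (- {p. e \<in> p}))"
    by (rule measure_Pi_pmf_Pi) simp
  ultimately show ?thesis by (simp only: prob_pmf_Compl)
qed

lemma prob_pmf_of_disjoint_set_le:
  assumes "finite M" "M \<noteq> {}" "disjoint M"
  shows "measure_pmf.prob (pmf_of_set M) {p. e \<in> p} \<le> 1 / card M"
proof -
  have "\<forall>p \<in> M \<inter> {p. e \<in> p}. \<forall>q \<in> M \<inter> {p. e \<in> p}. p = q"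
    using assms(3) by (auto dest: disjointD)
  then have "card (M \<inter> {p. e \<in> p}) \<le> Suc 0"
    using assms(1) by (subst card_le_Suc0_iff_eq) auto
  then have "real (card (M \<inter> {p. e \<in> p})) \<le> 1" by linarith
  then show ?thesis using assms by (simp add: measure_pmf_of_set divide_right_mono)
qed

section \<open>Relations between the classes of strategies\<close>

lemma Pi_pmf_in_correlated:
  assumes "\<And>i. i < n \<Longrightarrow> q i \<in> distributions (st_paths G s t)"
  shows "Pi_pmf {..<n} undefined q \<in> correlated_strategies G s t n"
  using assms
  by (fastforce simp: correlated_strategies_def distributions_def agent_profiles_def
      set_Pi_pmf PiE_dflt_def PiE_def extensional_def Pi_def)

lemma uncorrelated_subset_correlated:
  "uncorrelated_strategies G s t n \<subseteq> correlated_strategies G s t n"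
  by (auto simp: uncorrelated_strategies_def intro!: Pi_pmf_in_correlated)

text \<open>Correlated agents can all follow one sampled path, thereby imitating a single
  agent.\<close>

lemma copies_in_correlated:
  assumes "\<sigma> \<in> correlated_strategies G s t 1"
  shows "map_pmf (\<lambda>a. \<lambda>i\<in>{..<n}. a 0) \<sigma> \<in> correlated_strategies G s t n"
  using assms by (fastforce simp: correlated_strategies_def distributions_def agent_profiles_def)

lemma worst_cost_copies:
  assumes "n \<ge> 1"
  shows "worst_cost G n k \<alpha> (map_pmf (\<lambda>a. \<lambda>i\<in>{..<n}. a 0) \<sigma>) = worst_cost G 1 k \<alpha> \<sigma>"
proof -
  have "0 \<in> {..<n}" using assms by simp
  then have "(\<Union>i<n. (\<lambda>i\<in>{..<n}. a 0) i) = (\<Union>i<1. a i)" for a :: "nat \<Rightarrow> 'b set"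
    by auto
  then show ?thesis by (simp only: worst_cost_def sum_cost_def integral_map_pmf)
qed

section \<open>Bounds on the worst-case cost\<close>

context st_graph
begin

lemma shortest_le_card: "p \<in> st_paths G s t \<Longrightarrow> shortest_path_length G s t \<le> card p"
  using finite_st_paths by (auto simp: shortest_path_length_def)

lemma card_le_longest: "p \<in> st_paths G s t \<Longrightarrow> card p \<le> longest_path_length G s t"
  using finite_st_paths by (auto simp: longest_path_length_def)

lemma st_paths_nonempty: "st_paths G s t \<noteq> {}"
  using arcs_nonempty arc_on_st_path by blast

lemma finite_set_pmf_correlated:
  assumes "\<sigma> \<in> correlated_strategies G s t n"
  shows "finite (set_pmf \<sigma>)"
proof (rule finite_subset)
  show "set_pmf \<sigma> \<subseteq> agent_profiles G s t n"
    using assms by (simp add: correlated_strategies_def distributions_def)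
  show "finite (agent_profiles G s t n)"
    unfolding agent_profiles_def by (intro finite_PiE finite_lessThan finite_st_paths)
qed

lemma correlated_profile:
  assumes "\<sigma> \<in> correlated_strategies G s t n" "a \<in> set_pmf \<sigma>" "i < n"
  shows "a i \<in> st_paths G s t"
  using assms by (auto simp: correlated_strategies_def distributions_def agent_profiles_def)

lemma expectation_sum_cost:
  assumes "\<sigma> \<in> correlated_strategies G s t n"
  shows "measure_pmf.expectation \<sigma> (\<lambda>a. sum_cost n k \<alpha> a d) =
    measure_pmf.expectation \<sigma> (\<lambda>a. real (card (\<Union>i<n. a i))) +
    \<alpha> * (\<Sum>j<k. measure_pmf.prob \<sigma> {a. d j \<in> (\<Union>i<n. a i)})"
proof -
  have int: "integrable \<sigma> f" for f :: "(nat \<Rightarrow> 'b set) \<Rightarrow> real"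
    by (rule integrable_measure_pmf_finite[OF finite_set_pmf_correlated[OF assms]])
  have ind: "of_bool (x \<in> (\<Union>i<n. a i)) = (indicator {a. x \<in> (\<Union>i<n. a i)} a :: real)" for x a
    by (simp add: indicator_def)
  show ?thesis
    unfolding sum_cost_def ind
    by (subst Bochner_Integration.integral_add[OF int int])
      (simp add: Bochner_Integration.integral_sum[OF int])
qed

lemma finite_interceptor_profiles: "finite (interceptor_profiles G k)"
  by (auto simp: interceptor_profiles_def intro: finite_PiE)

lemma interceptor_profiles_nonempty: "interceptor_profiles G k \<noteq> {}"
  using arcs_nonempty by (auto simp: interceptor_profiles_def PiE_eq_empty_iff)

text \<open>All interceptors sit on the same arc \<open>e\<close>; the path of agent 0 alone already
  accounts for the shortest path length.\<close>

lemma worst_cost_ge: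
  assumes "\<sigma> \<in> correlated_strategies G s t n" "n \<ge> 1" "e \<in> arcs G" "\<alpha> \<ge> 0"
    and "\<beta> \<le> measure_pmf.prob \<sigma> {a. e \<in> (\<Union>i<n. a i)}"
  shows "real (shortest_path_length G s t) + \<alpha> * (real k * \<beta>) \<le> worst_cost G n k \<alpha> \<sigma>"
proof -
  let ?d = "\<lambda>j\<in>{..<k}. e"
  have d: "?d \<in> interceptor_profiles G k"
    using assms(3) by (simp add: interceptor_profiles_def)
  have "shortest_path_length G s t \<le> card (\<Union>i<n. a i)" if a: "a \<in> set_pmf \<sigma>" for a
  proof -
    have p: "a i \<in> st_paths G s t" if "i < n" for i
      using correlated_profile[OF assms(1) a that] .
    then have "(\<Union>i<n. a i) \<subseteq> arcs G" using st_path_subset_arcs by blast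
    then have "card (a 0) \<le> card (\<Union>i<n. a i)"
      using assms(2) by (intro card_mono UN_upper finite_subset[OF _ finite_arcs]) simp_all
    moreover have "shortest_path_length G s t \<le> card (a 0)"
      using p assms(2) by (intro shortest_le_card) simp
    ultimately show ?thesis by simp
  qed
  then have "real (shortest_path_length G s t) \<le>
      measure_pmf.expectation \<sigma> (\<lambda>a. real (card (\<Union>i<n. a i)))"
    by (intro measure_pmf.integral_ge_const integrable_measure_pmf_finite
        finite_set_pmf_correlated[OF assms(1)]) (simp add: AE_measure_pmf_iff)
  moreover have "real k * \<beta> \<le> (\<Sum>j<k. measure_pmf.prob \<sigma> {a. ?d j \<in> (\<Union>i<n. a i)})"
    using assms(5) by (simp add: mult_left_mono)
  ultimately have "real (shortest_path_length G s t) + \<alpha> * (real k * \<beta>) \<le>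
      measure_pmf.expectation \<sigma> (\<lambda>a. sum_cost n k \<alpha> a ?d)"
    unfolding expectation_sum_cost[OF assms(1)] using assms(4)
    by (intro add_mono mult_left_mono) auto
  also have "\<dots> \<le> worst_cost G n k \<alpha> \<sigma>"
    unfolding worst_cost_def using d finite_interceptor_profiles by (intro Max_ge) auto
  finally show ?thesis .
qed

text \<open>A bound on the hitting probability that is uniform in the arc bounds every placement of
  interceptors at once, by linearity of expectation.\<close>

lemma worst_cost_le:
  assumes "\<sigma> \<in> correlated_strategies G s t n" "\<alpha> \<ge> 0"
    and "\<And>e. measure_pmf.prob \<sigma> {a. e \<in> (\<Union>i<n. a i)} \<le> \<beta>"
  shows "worst_cost G n k \<alpha> \<sigma> \<le> real n * real (longest_path_length G s t) + \<alpha> * (real k * \<beta>)"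
  unfolding worst_cost_def
proof (rule Max.boundedI)
  fix x
  assume "x \<in> (\<lambda>d. measure_pmf.expectation \<sigma> (\<lambda>a. sum_cost n k \<alpha> a d)) ` interceptor_profiles G k"
  then obtain d where x: "x = measure_pmf.expectation \<sigma> (\<lambda>a. sum_cost n k \<alpha> a d)" by auto
  have "card (\<Union>i<n. a i) \<le> n * longest_path_length G s t" if "a \<in> set_pmf \<sigma>" for a
  proof -
    have "card (\<Union>i<n. a i) \<le> (\<Sum>i<n. card (a i))" by (rule card_UN_le) simp
    also have "\<dots> \<le> (\<Sum>i<n. longest_path_length G s t)"
      using correlated_profile[OF assms(1) that] by (intro sum_mono card_le_longest) simp
    finally show ?thesis by simp
  qed
  then have "real (card (\<Union>i<n. a i)) \<le> real n * real (longest_path_length G s t)"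
    if "a \<in> set_pmf \<sigma>" for a
    using that by (metis of_nat_le_iff of_nat_mult)
  then have "measure_pmf.expectation \<sigma> (\<lambda>a. real (card (\<Union>i<n. a i))) \<le>
      real n * real (longest_path_length G s t)"
    by (intro measure_pmf.integral_le_const integrable_measure_pmf_finite
        finite_set_pmf_correlated[OF assms(1)]) (simp add: AE_measure_pmf_iff)
  moreover have "(\<Sum>j<k. measure_pmf.prob \<sigma> {a. d j \<in> (\<Union>i<n. a i)}) \<le> real k * \<beta>"
    using sum_mono[of "{..<k}" "\<lambda>j. measure_pmf.prob \<sigma> {a. d j \<in> (\<Union>i<n. a i)}" "\<lambda>_. \<beta>"] assms(3)
    by simp
  ultimately show "x \<le> real n * real (longest_path_length G s t) + \<alpha> * (real k * \<beta>)"
    unfolding x expectation_sum_cost[OF assms(1)] using assms(2)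
    by (intro add_mono mult_left_mono) auto
qed (use finite_interceptor_profiles interceptor_profiles_nonempty in auto)

lemma st_cut_meets_path: "st_cut G s t K \<Longrightarrow> p \<in> st_paths G s t \<Longrightarrow> p \<inter> K \<noteq> {}"
  using st_path_subset_arcs[of p s t] unfolding st_cut_def by blast

lemma st_cut_finite_nonempty:
  assumes "st_cut G s t K"
  shows "finite K" "K \<noteq> {}"
proof -
  show "finite K" using assms by (auto simp: st_cut_def intro: finite_subset[OF _ finite_arcs])
  show "K \<noteq> {}" using assms st_paths_nonempty st_cut_meets_path by blast
qed

text \<open>The hitting probabilities over the cut sum to at least 1, so some arc attains the
  average.\<close>

lemma correlated_hits_cut:
  assumes "st_cut G s t K" "\<sigma> \<in> correlated_strategies G s t n" "n \<ge> 1"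
  shows "\<exists>e\<in>K. 1 / real (card K) \<le> measure_pmf.prob \<sigma> {a. e \<in> (\<Union>i<n. a i)}"
proof (rule ccontr)
  assume neg: "\<not> ?thesis"
  note K = st_cut_finite_nonempty[OF assms(1)]
  have "(\<Union>i<n. a i) \<inter> K \<noteq> {}" if "a \<in> set_pmf \<sigma>" for a
    using st_cut_meets_path[OF assms(1) correlated_profile[OF assms(2) that, of 0]] assms(3) by force
  then have "1 \<le> (\<Sum>e\<in>K. measure_pmf.prob \<sigma> {a. e \<in> (\<Union>i<n. a i)})"
    using K by (intro sum_prob_hits_ge_1[where f = "\<lambda>a. \<Union>i<n. a i"])
  also have "\<dots> < (\<Sum>e\<in>K. 1 / real (card K))"
    using K neg by (intro sum_strict_mono) auto
  also have "\<dots> = 1" using K by simp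
  finally show False by simp
qed

text \<open>Each agent's avoidance probabilities over a cut of size m sum to at most m - 1, so by
  AM-GM their product is at most (1 - 1/m)^m. Multiplying over the agents and exchanging the
  products bounds the product over the cut of the probabilities that everyone avoids the arc; these
  cannot all exceed (1 - 1/m)^n.\<close>

lemma uncorrelated_hits_cut:
  assumes "st_cut G s t K" "\<sigma> \<in> uncorrelated_strategies G s t n"
  shows "\<exists>e\<in>K. 1 - (1 - 1 / real (card K)) ^ n \<le> measure_pmf.prob \<sigma> {a. e \<in> (\<Union>i<n. a i)}"
proof (rule ccontr)
  assume neg: "\<not> ?thesis"
  note K = st_cut_finite_nonempty[OF assms(1)]
  let ?m = "card K"
  have m: "real ?m \<ge> 1" using K by (simp add: Suc_leI card_gt_0_iff)
  obtain q where q: "q \<in> {..<n} \<rightarrow>\<^sub>E distributions (st_paths G s t)"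
    and \<sigma>: "\<sigma> = Pi_pmf {..<n} undefined q"
    using assms(2) by (auto simp: uncorrelated_strategies_def)
  \<comment> \<open>Probability that agent \<open>i\<close> avoids the arc \<open>e\<close>.\<close>
  define x where "x i e = 1 - measure_pmf.prob (q i) {p. e \<in> p}" for i e
  have x: "x i e \<ge> 0" for i e by (simp add: x_def)
  have "(\<Prod>e\<in>K. x i e) \<le> (1 - 1 / ?m) ^ ?m" if "i < n" for i
  proof -
    have "set_pmf (q i) \<subseteq> st_paths G s t" using q that by (auto simp: distributions_def)
    then have "1 \<le> (\<Sum>e\<in>K. measure_pmf.prob (q i) {p. e \<in> p})"
      using K st_cut_meets_path[OF assms(1)] by (intro sum_prob_hits_ge_1[where f = "\<lambda>p. p"]) auto
    then have "(\<Sum>e\<in>K. x i e) \<le> ?m - 1" by (simp add: x_def sum_subtractf)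
    then have "(\<Sum>e\<in>K. x i e) / ?m \<le> 1 - 1 / ?m" using m by (simp add: field_simps)
    moreover have "(\<Sum>e\<in>K. x i e) / ?m \<ge> 0" using x by (simp add: sum_nonneg)
    ultimately show ?thesis
      using prod_le_mean_power[OF K, of "x i"] x by (meson order_trans power_mono)
  qed
  then have "(\<Prod>i<n. \<Prod>e\<in>K. x i e) \<le> (\<Prod>i<n. (1 - 1 / ?m) ^ ?m)"
    using x by (intro prod_mono) (auto intro: prod_nonneg)
  then have "(\<Prod>e\<in>K. \<Prod>i<n. x i e) \<le> ((1 - 1 / ?m) ^ n) ^ ?m"
    by (subst prod.swap) (simp add: mult.commute flip: power_mult)
  moreover have "(\<Prod>e\<in>K. (1 - 1 / real ?m) ^ n) < (\<Prod>e\<in>K. \<Prod>i<n. x i e)"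
  proof -
    have gt: "(1 - 1 / real ?m) ^ n < (\<Prod>i<n. x i e)" if "e \<in> K" for e
    proof -
      have "measure_pmf.prob \<sigma> {a. e \<in> (\<Union>i<n. a i)} < 1 - (1 - 1 / real ?m) ^ n"
        using neg that by (meson not_le)
      then show ?thesis by (simp only: \<sigma> prob_Union_Pi_pmf x_def)
    qed
    have ge: "0 \<le> (1 - 1 / real ?m) ^ n" using m by simp
    obtain e where "e \<in> K" using K(2) by blast
    then show ?thesis
      using gt ge K(1) by (intro prod_mono_strict[of e]) (auto intro: less_imp_le le_less_trans)
  qed
  ultimately show False by simp
qed

section \<open>Uniform strategies on disjoint paths\<close>

lemma path_prefix_of_max_disjoint:
  assumes "M \<in> max_disjoint_path_sets G s t" "P \<in> path_prefixes M"
  shows "P \<subseteq> st_paths G s t" "finite P" "P \<noteq> {}"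
  using assms set_take_subset by (fastforce simp: max_disjoint_path_sets_def path_prefixes_def)+

lemma uniform_subset_uncorrelated:
  "uniform_strategies G s t n \<subseteq> uncorrelated_strategies G s t n"
proof
  fix \<sigma> assume "\<sigma> \<in> uniform_strategies G s t n"
  then obtain M P where \<sigma>: "\<sigma> = Pi_pmf {..<n} undefined (\<lambda>_. pmf_of_set P)"
    and MP: "M \<in> max_disjoint_path_sets G s t" "P \<in> path_prefixes M"
    by (auto simp: uniform_strategies_def)
  note P = path_prefix_of_max_disjoint[OF MP]
  \<comment> \<open>The constant family is not extensional; restricting it to the agents' indices
    leaves the product distribution unchanged.\<close>
  have "\<sigma> = Pi_pmf {..<n} undefined (\<lambda>i\<in>{..<n}. pmf_of_set P)"
    unfolding \<sigma> by (rule Pi_pmf_cong) auto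
  moreover have "(\<lambda>i\<in>{..<n}. pmf_of_set P) \<in> {..<n} \<rightarrow>\<^sub>E distributions (st_paths G s t)"
    using P by (auto simp: distributions_def)
  ultimately show "\<sigma> \<in> uncorrelated_strategies G s t n"
    by (auto simp: uncorrelated_strategies_def)
qed

lemma finite_uniform_strategies: "finite (uniform_strategies G s t n)"
proof -
  have "uniform_strategies G s t n \<subseteq>
      (\<lambda>P. Pi_pmf {..<n} undefined (\<lambda>_. pmf_of_set P)) ` Pow (st_paths G s t)"
    using path_prefix_of_max_disjoint(1) by (fastforce simp: uniform_strategies_def)
  then show ?thesis by (rule finite_subset) (simp add: finite_st_paths)
qed

text \<open>The full family, sorted by length, is its own longest prefix.\<close>

lemma self_path_prefix:
  assumes "finite M" "M \<noteq> {}"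
  shows "M \<in> path_prefixes M"
proof -
  obtain xs where xs: "set xs = M" "distinct xs" using finite_distinct_list[OF assms(1)] by blast
  let ?ps = "sort_key card xs"
  have "set (take (length ?ps) ?ps) = M" "set ?ps = M" "distinct ?ps" "sorted (map card ?ps)"
    "1 \<le> length ?ps"
    using xs assms(2) by (auto simp: Suc_le_eq)
  then show ?thesis unfolding path_prefixes_def by blast
qed

text \<open>On a Menger family of m disjoint paths each agent uses a given arc with probability at
  most 1/m. The interception term thus equals that of the lower bound for uncorrelated agents, and
  for \<open>n = 1\<close> that for correlated ones.\<close>

lemma good_uniform_strategy:
  assumes "\<alpha> \<ge> 0"
  shows "\<exists>\<sigma> \<in> uniform_strategies G s t n. worst_cost G n k \<alpha> \<sigma> \<le>
    real n * real (longest_path_length G s t) +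
    \<alpha> * (real k * (1 - (1 - 1 / real (min_cut G s t)) ^ n))"
proof -
  obtain M K where M: "M \<in> max_disjoint_path_sets G s t" "card M = min_cut G s t"
    and K: "st_cut G s t K" "card K = min_cut G s t"
    using menger[OF source_in_verts source_neq_sink[symmetric]] by metis
  have pos: "min_cut G s t > 0"
    using st_cut_finite_nonempty[OF K(1)] K(2) by (metis card_gt_0_iff)
  have fin: "finite M" "M \<noteq> {}" using pos M(2) by (metis card_gt_0_iff)+
  let ?\<sigma> = "Pi_pmf {..<n} undefined (\<lambda>_. pmf_of_set M)"
  have U: "?\<sigma> \<in> uniform_strategies G s t n"
    using M(1) self_path_prefix[OF fin] by (auto simp: uniform_strategies_def)
  have "measure_pmf.prob ?\<sigma> {a. e \<in> (\<Union>i<n. a i)} \<le> 1 - (1 - 1 / real (min_cut G s t)) ^ n" for e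
  proof -
    have "disjoint M" using M(1) by (simp add: max_disjoint_path_sets_def)
    from prob_pmf_of_disjoint_set_le[OF fin this, of e]
    have "(1 - 1 / real (min_cut G s t)) ^ n \<le>
        (1 - measure_pmf.prob (pmf_of_set M) {p. e \<in> p}) ^ n"
      using pos M(2) by (intro power_mono) auto
    then show ?thesis by (simp only: prob_Union_Pi_pmf) simp
  qed
  moreover have "?\<sigma> \<in> correlated_strategies G s t n"
    using U uniform_subset_uncorrelated uncorrelated_subset_correlated by (meson subsetD)
  ultimately show ?thesis
    using assms by (intro bexI[OF _ U] worst_cost_le)
qed

end

section \<open>Comparison of the two prices\<close>

theorem theorem6:
  fixes G :: "('a, 'b) pre_digraph" and s t :: 'a
    and n k :: nat and \<epsilon> \<alpha> :: real
  assumes "st_graph G s t"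
    and "n \<ge> 1" and "k \<ge> 1"
    and "\<epsilon> > 0" and "\<alpha> > 0"
    and "\<alpha> \<ge> real (min_cut G s t) / (real k * \<epsilon>) *
           (real n * real (longest_path_length G s t)
             - (1 + \<epsilon>) * real (shortest_path_length G s t))"
  shows "price_of_uncorrelation G s t n k \<alpha> / uniform_price_of_uncorrelation G s t n k \<alpha>
           \<in> {1 / (1 + \<epsilon>) .. 1 + \<epsilon>}"
proof -
  interpret st_graph G s t by fact
  define L where "L = real (longest_path_length G s t)"
  define l where "l = real (shortest_path_length G s t)"
  define m where "m = real (min_cut G s t)"
  define \<beta> where "\<beta> = 1 - (1 - 1 / m) ^ n"
  define X where "X = (INF \<sigma> \<in> uncorrelated_strategies G s t n. worst_cost G n k \<alpha> \<sigma>)"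
  define Y where "Y = (INF \<sigma> \<in> correlated_strategies G s t n. worst_cost G n k \<alpha> \<sigma>)"
  define A where "A = (MIN \<sigma> \<in> uniform_strategies G s t n. worst_cost G n k \<alpha> \<sigma>)"
  define B where "B = (MIN \<sigma> \<in> uniform_strategies G s t 1. worst_cost G 1 k \<alpha> \<sigma>)"
  obtain K where K: "st_cut G s t K" and card_K: "real (card K) = m"
    using menger[OF source_in_verts source_neq_sink[symmetric]] unfolding m_def by metis
  have m: "m \<ge> 1"
    using st_cut_finite_nonempty[OF K] card_K 
    by (metis One_nat_def Suc_leI card_gt_0_iff of_nat_1 of_nat_le_iff)
  have K_arcs: "e \<in> arcs G" if "e \<in> K" for e using K that by (auto simp: st_cut_def)
  have nL: "L \<le> real n * L" and l0: "l \<ge> 0"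
    using assms(2) by (simp_all add: L_def l_def mult_le_cancel_right1)
  have "(1 - 1 / m) ^ n \<le> (1 - 1 / m) ^ 1" using m assms(2) by (intro power_decreasing) auto
  then have \<beta>: "1 / m \<le> \<beta>" by (simp add: \<beta>_def)
  have pos: "0 < \<alpha> * (real k * (1 / m))" using assms(3,5) m by simp
  \<comment> \<open>The hypothesis on \<alpha> with its denominators cleared.\<close>
  have main: "n * L - (1 + \<epsilon>) * l \<le> \<epsilon> * (\<alpha> * (real k * (1 / m)))"
    using assms(3-6) m unfolding L_def l_def m_def by (simp add: field_simps)
  \<comment> \<open>The excess length is absorbed by \<epsilon> times the interception term, which
    grows with \<open>b\<close>. It is used with \<open>b\<close> equal to \<beta> for
    \<open>n\<close> agents and to \<open>1 / m\<close> for one agent.\<close>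
  have key: "n * L + \<alpha> * (real k * b) \<le> (1 + \<epsilon>) * (l + \<alpha> * (real k * b))" if "1 / m \<le> b" for b
  proof -
    have "\<epsilon> * (\<alpha> * (real k * (1 / m))) \<le> \<epsilon> * (\<alpha> * (real k * b))"
      using that assms(3-5) by (intro mult_left_mono) auto
    with main show ?thesis by (simp add: algebra_simps)
  qed

  have lower_corr: "l + \<alpha> * (real k * (1 / m)) \<le> worst_cost G n k \<alpha> \<sigma>"
    if "\<sigma> \<in> correlated_strategies G s t n" for \<sigma>
    using correlated_hits_cut[OF K that assms(2)] worst_cost_ge[OF that assms(2) K_arcs]
      assms(5) card_K unfolding l_def by (metis less_imp_le)
  have lower_uncorr: "l + \<alpha> * (real k * \<beta>) \<le> worst_cost G n k \<alpha> \<sigma>"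
    if "\<sigma> \<in> uncorrelated_strategies G s t n" for \<sigma>
    using uncorrelated_hits_cut[OF K that]
      worst_cost_ge[OF subsetD[OF uncorrelated_subset_correlated that] assms(2) K_arcs]
      assms(5) card_K unfolding l_def \<beta>_def by (metis less_imp_le)
  obtain \<tau>1 where \<tau>1: "\<tau>1 \<in> uniform_strategies G s t 1"
    "worst_cost G 1 k \<alpha> \<tau>1 \<le> L + \<alpha> * (real k * (1 / m))"
    using good_uniform_strategy[of \<alpha> 1 k] assms(5) unfolding L_def m_def by auto
  obtain \<tau> where \<tau>: "\<tau> \<in> uniform_strategies G s t n"
    "worst_cost G n k \<alpha> \<tau> \<le> n * L + \<alpha> * (real k * \<beta>)"
    using good_uniform_strategy[of \<alpha> n k] assms(5) unfolding L_def m_def \<beta>_def by auto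

  have \<tau>_uncorr: "\<tau> \<in> uncorrelated_strategies G s t n"
    using \<tau>(1) uniform_subset_uncorrelated by blast
  have X_ge: "l + \<alpha> * (real k * \<beta>) \<le> X"
    unfolding X_def using \<tau>_uncorr lower_uncorr by (intro cINF_greatest) auto
  have Y_ge: "l + \<alpha> * (real k * (1 / m)) \<le> Y"
    unfolding Y_def using subsetD[OF uncorrelated_subset_correlated \<tau>_uncorr] lower_corr
    by (intro cINF_greatest) auto
  \<comment> \<open>An infimum of reals is a lower bound only for sets bounded below; this also
    serves the smaller class of uncorrelated strategies.\<close>
  have bdd: "bdd_below (worst_cost G n k \<alpha> ` correlated_strategies G s t n)"
    using lower_corr by (intro bdd_belowI2)
  have "A \<in> worst_cost G n k \<alpha> ` uniform_strategies G s t n"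
    unfolding A_def using \<tau>(1) finite_uniform_strategies by (intro Min_in) auto
  then have XA: "X \<le> A"
    unfolding X_def using uniform_subset_uncorrelated
    by (auto intro!: cINF_lower
        bdd_below_mono[OF bdd image_mono[OF uncorrelated_subset_correlated]])
  have "B \<in> worst_cost G 1 k \<alpha> ` uniform_strategies G s t 1"
    unfolding B_def using \<tau>1(1) finite_uniform_strategies by (intro Min_in) auto
  then obtain \<sigma> where \<sigma>: "\<sigma> \<in> uniform_strategies G s t 1" "B = worst_cost G 1 k \<alpha> \<sigma>" by auto
  then have "\<sigma> \<in> correlated_strategies G s t 1"
    using uniform_subset_uncorrelated uncorrelated_subset_correlated by (meson subsetD)
  from cINF_lower[OF bdd copies_in_correlated[OF this]] have YB: "Y \<le> B"
    unfolding Y_def \<sigma>(2) worst_cost_copies[OF assms(2)] .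
  have "A \<le> worst_cost G n k \<alpha> \<tau>"
    unfolding A_def using \<tau>(1) finite_uniform_strategies by (intro Min_le) auto
  also have "\<dots> \<le> (1 + \<epsilon>) * (l + \<alpha> * (real k * \<beta>))" using \<tau>(2) key[OF \<beta>] by simp
  also have "\<dots> \<le> (1 + \<epsilon>) * X" using X_ge assms(4) by (intro mult_left_mono) auto
  finally have AX: "A \<le> (1 + \<epsilon>) * X" .
  have "B \<le> worst_cost G 1 k \<alpha> \<tau>1"
    unfolding B_def using \<tau>1(1) finite_uniform_strategies by (intro Min_le) auto
  \<comment> \<open>Since \<open>L\<close> is at most \<open>n * L\<close>, the estimate for
    \<open>n\<close> agents also covers a single agent.\<close>
  also have "\<dots> \<le> (1 + \<epsilon>) * (l + \<alpha> * (real k * (1 / m)))"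
    using \<tau>1(2) nL key[OF order_refl] by linarith
  also have "\<dots> \<le> (1 + \<epsilon>) * Y" using Y_ge assms(4) by (intro mult_left_mono) auto
  finally have BY: "B \<le> (1 + \<epsilon>) * Y" .

  have Y0: "Y > 0" using Y_ge l0 pos by linarith
  have "\<alpha> * (real k * (1 / m)) \<le> \<alpha> * (real k * \<beta>)"
    using \<beta> assms(5) by (intro mult_left_mono) auto
  then have X0: "X > 0" using X_ge l0 pos by linarith
  \<comment> \<open>Regrouping pairs each optimum with its uniform counterpart, so that each factor
    is controlled by one upper and one lower comparison.\<close>
  have ratio: "price_of_uncorrelation G s t n k \<alpha> / uniform_price_of_uncorrelation G s t n k \<alpha> =
      (X / A) * (B / Y)"
    by (simp add: price_of_uncorrelation_def uniform_price_of_uncorrelation_def X_def Y_def A_def B_def)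
  have A0: "A > 0" using XA X0 by linarith
  have XA': "1 / (1 + \<epsilon>) \<le> X / A" "X / A \<le> 1"
    using AX XA A0 assms(4) by (simp_all add: field_simps)
  have BY': "1 \<le> B / Y" "B / Y \<le> 1 + \<epsilon>"
    using BY YB Y0 by (simp_all add: field_simps)
  have "1 / (1 + \<epsilon>) * 1 \<le> (X / A) * (B / Y)"
    using XA' BY' X0 A0 assms(4) by (intro mult_mono) auto
  moreover have "(X / A) * (B / Y) \<le> 1 * (1 + \<epsilon>)"
    using XA' BY' X0 A0 assms(4) by (intro mult_mono) auto
  ultimately show ?thesis unfolding ratio by simp
qed

end
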